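(* Let $B(z)$ be analytic at $z=0$ with $B(0)=1$, and let $r,n\in\mathbb{N}_0$ with $0\le r\le n$. Then for $x\in\mathbb{R}$, \[ \frac{P_n^{(r)}(B;x)}{r!}=\sum_{k=r}^{n}\binom{k}{r}s_B(n,k)x^{k-r}=\sum_{j=r}^{n}\binom{n}{j}s_B(j,r)P_{n-j}(B;x), \] \[ \frac{\Delta^rP_n(B;x)}{r!}=\sum_{k=r}^{n}\binom{k}{r}S_B(n,k)(x)_{k-r}=\sum_{j=r}^{n}\binom{n}{j}S_B(j,r)P_{n-j}(B;x). \] In particular, $\frac{P_n^{(r)}(B;0)}{r!}=s_B(n,r)$ and $\frac{\Delta^rP_n(B;0)}{r!}=S_B(n,r)$.
   Context: For $B$ analytic at $0$ with $B(0)=1$, $\log B(z)$ is the branch with $\log B(0)=0$ near $0$ and $(B(z))^x=\exp(x\log B(z))$. Potential polynomials: $\sum_{n\ge0}P_n(B;x)\frac{z^n}{n!}=(B(z))^x$; $P_n^{(r)}$ is the $r$-th derivative in $x$. $B$-Stirling numbers: $\frac{(\log B(z))^k}{k!}=\sum_{n\ge k}s_B(n,k)\frac{z^n}{n!}$, $\frac{(B(z)-1)^k}{k!}=\sum_{n\ge k}S_B(n,k)\frac{z^n}{n!}$. Forward differences: $\Delta^rf(x)=\sum_{j=0}^r\binom{r}{j}(-1)^{r-j}f(x+j)$. Falling factorial $(x)_k=x(x-1)\cdots(x-k+1)$, $(x)_0=1$. *)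

theory Defs
  imports "HOL-Complex_Analysis.Complex_Analysis"
begin

text \<open>The coefficients \<open>c\<^sub>n\<close> in \<open>f z = (\<Sum>n. c\<^sub>n * z ^ n / fact n)\<close> near \<open>0\<close>, for \<open>f\<close> analytic at \<open>0\<close>.\<close>

definition egf_coeff :: "(complex \<Rightarrow> complex) \<Rightarrow> nat \<Rightarrow> complex" where
  "egf_coeff f n = fact n * fps_nth (fps_expansion f 0) n"

text \<open>
  If \<open>B\<close> is analytic at \<open>0\<close> with \<open>B 0 = 1\<close>, then \<open>B z\<close> is close to \<open>1\<close> for \<open>z\<close> near \<open>0\<close>, so the
  branch of \<open>log B(z)\<close> near \<open>0\<close> with \<open>log B(0) = 0\<close> is the principal one. The coefficients below
  depend only on the germ at \<open>0\<close>.
\<close>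

definition log_branch :: "(complex \<Rightarrow> complex) \<Rightarrow> complex \<Rightarrow> complex" where
  "log_branch B z = Ln (B z)"

definition potential_poly :: "(complex \<Rightarrow> complex) \<Rightarrow> nat \<Rightarrow> real \<Rightarrow> complex" where
  "potential_poly B n x = egf_coeff (\<lambda>z. exp (of_real x * log_branch B z)) n"

definition stirling1_B :: "(complex \<Rightarrow> complex) \<Rightarrow> nat \<Rightarrow> nat \<Rightarrow> complex" where
  "stirling1_B B n k = egf_coeff (\<lambda>z. log_branch B z ^ k / fact k) n"

definition stirling2_B :: "(complex \<Rightarrow> complex) \<Rightarrow> nat \<Rightarrow> nat \<Rightarrow> complex" where
  "stirling2_B B n k = egf_coeff (\<lambda>z. (B z - 1) ^ k / fact k) n"

definition nth_vector_derivative :: "nat \<Rightarrow> (real \<Rightarrow> 'a::real_normed_vector) \<Rightarrow> real \<Rightarrow> 'a" where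
  "nth_vector_derivative r f = ((\<lambda>g t. vector_derivative g (at t)) ^^ r) f"

definition forward_diff :: "nat \<Rightarrow> (real \<Rightarrow> complex) \<Rightarrow> real \<Rightarrow> complex" where
  "forward_diff r f x = (\<Sum>j=0..r. of_nat (r choose j) * (-1) ^ (r - j) * f (x + real j))"

definition falling_factorial :: "real \<Rightarrow> nat \<Rightarrow> real" where
  "falling_factorial x k = (\<Prod>i<k. x - real i)"

text \<open>The generating functions that characterise the above coefficients.\<close>

lemma egf_coeff_sums:
  assumes "f analytic_on {0}"
  shows "\<forall>\<^sub>F z in nhds 0. (\<lambda>n. egf_coeff f n * z ^ n / fact n) sums f z"
proof -
  have e: "f has_fps_expansion fps_expansion f 0"
    by (rule analytic_at_imp_has_fps_expansion_0[OF assms])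
  let ?F = "fps_expansion f 0"
  have r: "fps_conv_radius ?F > 0" and ev: "\<forall>\<^sub>F z in nhds 0. eval_fps ?F z = f z"
    using e by (auto simp: has_fps_expansion_def)
  have "\<forall>\<^sub>F z in nhds 0. z \<in> eball 0 (fps_conv_radius ?F)"
    using r by (intro eventually_nhds_in_open) (auto simp: zero_ereal_def)
  with ev show ?thesis
  proof eventually_elim
    case (elim z)
    have "(\<lambda>n. fps_nth ?F n * z ^ n) sums eval_fps ?F z"
      using elim by (intro sums_eval_fps) (auto simp: in_eball_iff)
    thus ?case using elim by (simp add: egf_coeff_def)
  qed
qed

lemma
  assumes "B analytic_on {0}" "B 0 = 1"
  shows log_branch_analytic: "log_branch B analytic_on {0}"
    and log_branch_0: "log_branch B 0 = 0"
    and exp_log_branch: "\<forall>\<^sub>F z in nhds 0. exp (log_branch B z) = B z"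
proof -
  show "log_branch B analytic_on {0}"
    unfolding log_branch_def using assms by (intro analytic_intros) auto
  show "log_branch B 0 = 0"
    using assms by (simp add: log_branch_def)
  have "isCont B 0"
    using assms(1) by (rule analytic_at_imp_isCont)
  hence "filterlim B (nhds 1) (nhds 0)"
    using assms(2) tendsto_at_iff_tendsto_nhds[of B 0] unfolding isCont_def by simp
  hence "\<forall>\<^sub>F z in nhds 0. B z \<noteq> 0"
    by (rule tendsto_imp_eventually_ne) simp
  thus "\<forall>\<^sub>F z in nhds 0. exp (log_branch B z) = B z"
    by eventually_elim (simp add: log_branch_def)
qed

lemma
  assumes "B analytic_on {0}" "B 0 = 1"
  shows potential_poly_sums: "\<forall>\<^sub>F z in nhds 0.
          (\<lambda>n. potential_poly B n x * z ^ n / fact n) sums exp (of_real x * log_branch B z)"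
    and stirling1_B_sums: "\<forall>\<^sub>F z in nhds 0.
          (\<lambda>n. stirling1_B B n k * z ^ n / fact n) sums (log_branch B z ^ k / fact k)"
    and stirling2_B_sums: "\<forall>\<^sub>F z in nhds 0.
          (\<lambda>n. stirling2_B B n k * z ^ n / fact n) sums ((B z - 1) ^ k / fact k)"
proof -
  have L: "log_branch B analytic_on {0}"
    by (rule log_branch_analytic[OF assms])
  have "(\<lambda>z. exp (of_real x * log_branch B z)) analytic_on {0}"
    by (intro analytic_intros L)
  thus "\<forall>\<^sub>F z in nhds 0.
      (\<lambda>n. potential_poly B n x * z ^ n / fact n) sums exp (of_real x * log_branch B z)"
    unfolding potential_poly_def by (rule egf_coeff_sums)
  have "(\<lambda>z. log_branch B z ^ k / fact k) analytic_on {0}"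
    by (intro analytic_on_divide analytic_on_power analytic_on_const L) auto
  thus "\<forall>\<^sub>F z in nhds 0.
      (\<lambda>n. stirling1_B B n k * z ^ n / fact n) sums (log_branch B z ^ k / fact k)"
    unfolding stirling1_B_def by (rule egf_coeff_sums)
  have "(\<lambda>z. (B z - 1) ^ k / fact k) analytic_on {0}"
    by (intro analytic_on_divide analytic_on_power analytic_on_diff analytic_on_const assms) auto
  thus "\<forall>\<^sub>F z in nhds 0.
      (\<lambda>n. stirling2_B B n k * z ^ n / fact n) sums ((B z - 1) ^ k / fact k)"
    unfolding stirling2_B_def by (rule egf_coeff_sums)
qed

lemma egf_coeff_power_below:
  assumes "f analytic_on {0}" "f 0 = 0" "n < k"
  shows "egf_coeff (\<lambda>z. f z ^ k / fact k) n = 0"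
proof -
  let ?F = "fps_expansion f 0"
  have 1: "(\<lambda>z. f z ^ k / fact k) has_fps_expansion (?F ^ k * fps_const (inverse (fact k)))"
    unfolding divide_inverse
    by (intro fps_expansion_intros analytic_at_imp_has_fps_expansion_0 assms)
  have 2: "(\<lambda>z. f z ^ k / fact k) has_fps_expansion fps_expansion (\<lambda>z. f z ^ k / fact k) 0"
    by (intro analytic_at_imp_has_fps_expansion_0 analytic_on_divide analytic_on_power
        analytic_on_const assms) auto
  have 3: "fps_expansion (\<lambda>z. f z ^ k / fact k) 0 = ?F ^ k * fps_const (inverse (fact k))"
    using 1 2 fps_expansion_unique_complex by blast
  have "fps_nth ?F 0 = 0"
    using assms by (simp add: fps_expansion_def)
  hence "fps_nth (?F ^ k) n = 0"
    using assms(3) startsby_zero_power_prefix by blast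
  thus ?thesis
    unfolding egf_coeff_def 3 by simp
qed

lemma
  assumes "B analytic_on {0}" "B 0 = 1" "n < k"
  shows stirling1_B_below: "stirling1_B B n k = 0"
    and stirling2_B_below: "stirling2_B B n k = 0"
proof -
  show "stirling1_B B n k = 0"
    unfolding stirling1_B_def
    using egf_coeff_power_below[OF log_branch_analytic log_branch_0] assms by blast
  have "(\<lambda>z. B z - 1) analytic_on {0}"
    by (intro analytic_on_diff analytic_on_const assms)
  thus "stirling2_B B n k = 0"
    unfolding stirling2_B_def using assms egf_coeff_power_below[of "\<lambda>z. B z - 1"] by simp
qed

end

theory Submission
  imports Defs
begin

text \<open>
  Put \<open>L = log B\<close> and \<open>U = B - 1\<close>, both vanishing at \<open>0\<close>. The function \<open>B(z)\<^sup>x\<close> is at the same time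
  \<open>E\<^sub>x \<circ> L\<close> with \<open>E\<^sub>x(t) = exp (x t)\<close> and \<open>G\<^sub>x \<circ> U\<close> with \<open>G\<^sub>x(t) = (1 + t)\<^sup>x\<close>. Applying \<open>d\<^sup>r/dx\<^sup>r\<close> to
  \<open>E\<^sub>x(t)\<close>, or \<open>\<Delta>\<^sup>r\<close> to \<open>G\<^sub>x(t)\<close>, multiplies it by \<open>t\<^sup>r\<close>. Hence all quantities are coefficients of
  \<open>L\<^sup>r B\<^sup>x\<close> and \<open>U\<^sup>r B\<^sup>x\<close>; reading these as the substitutions of \<open>L\<close> into \<open>t\<^sup>r E\<^sub>x(t)\<close> and of \<open>U\<close>
  into \<open>t\<^sup>r G\<^sub>x(t)\<close> gives the first sums, reading them as Cauchy products the second sums.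
\<close>

text \<open>As \<open>U ^ r\<close> is \<open>fps_X ^ r\<close> composed with \<open>U\<close>, the
  product on the right is \<open>fps_X ^ r * G\<close> composed with \<open>U\<close>. The shift by
  \<open>r\<close> leaves \<open>g (k - r) / fact (k - r)\<close>, and the factorials combine to
  \<open>k choose r\<close>.\<close>

lemma fps_compose_egf_nth:
  fixes G U :: "'a::field_char_0 fps"
  assumes U0: "fps_nth U 0 = 0" and G: "\<And>i. fps_nth G i = g i / fact i"
  shows "(\<Sum>k=r..n. of_nat (k choose r) * (fact n * (fps_nth (U ^ k) n / fact k)) * g (k - r))
           = fact n * fps_nth (U ^ r * (G oo U)) n / fact r"
proof -
  have "U ^ r * (G oo U) = (fps_X ^ r * G) oo U"
    using U0 by (simp add: fps_compose_mult_distrib flip: fps_compose_power)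
  hence "fps_nth (U ^ r * (G oo U)) n = (\<Sum>k=0..n. fps_nth (fps_X ^ r * G) k * fps_nth (U ^ k) n)"
    by (simp add: fps_compose_nth)
  also have "\<dots> = (\<Sum>k=r..n. g (k - r) / fact (k - r) * fps_nth (U ^ k) n)"
    by (rule sum.mono_neutral_cong_right) (auto simp: fps_X_power_mult_nth G)
  finally have "fact n * fps_nth (U ^ r * (G oo U)) n / fact r =
      (\<Sum>k=r..n. fact n * (g (k - r) / fact (k - r) * fps_nth (U ^ k) n) / fact r)"
    by (simp add: sum_distrib_left sum_divide_distrib)
  also have "\<dots> = (\<Sum>k=r..n. of_nat (k choose r) * (fact n * (fps_nth (U ^ k) n / fact k)) * g (k - r))"
    by (rule sum.cong) (auto simp: binomial_fact field_simps)
  finally show ?thesis ..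
qed

text \<open>The Cauchy product with factorials regrouped into \<open>n choose j\<close>; the
  vanishing of \<open>V\<close> below \<open>r\<close> lets the sum start at
  \<open>r\<close>.\<close>

lemma fps_mult_egf_nth:
  fixes V Q :: "'a::field_char_0 fps"
  assumes "\<And>j. j < r \<Longrightarrow> fps_nth V j = 0"
  shows "(\<Sum>j=r..n. of_nat (n choose j) * (fact j * (fps_nth V j / c)) * (fact (n - j) * fps_nth Q (n - j)))
           = fact n * fps_nth (V * Q) n / c"
proof -
  have "fact n * fps_nth (V * Q) n / c
      = (\<Sum>j=0..n. fact n * (fps_nth V j * fps_nth Q (n - j)) / c)"
    by (simp add: fps_mult_nth sum_distrib_left sum_divide_distrib)
  also have "\<dots> = (\<Sum>j=r..n. of_nat (n choose j) * (fact j * (fps_nth V j / c)) * (fact (n - j) * fps_nth Q (n - j)))"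
    by (rule sum.mono_neutral_cong_right) (auto simp: assms binomial_fact field_simps)
  finally show ?thesis ..
qed

lemma egf_coeff_eqI: "f has_fps_expansion F \<Longrightarrow> egf_coeff f n = fact n * fps_nth F n"
  by (simp add: egf_coeff_def fps_expansion_eqI)

lemma egf_coeff_power_divide_fact:
  assumes "f has_fps_expansion F"
  shows "egf_coeff (\<lambda>z. f z ^ k / fact k) n = fact n * (fps_nth (F ^ k) n / fact k)"
proof -
  have "(\<lambda>z. f z ^ k * inverse (fact k)) has_fps_expansion F ^ k * fps_const (inverse (fact k))"
    by (intro fps_expansion_intros assms)
  from egf_coeff_eqI[OF this] show ?thesis
    by (simp add: divide_inverse)
qed

lemma nth_vector_derivative_polynomial:
  fixes a :: "nat \<Rightarrow> complex"
  shows "nth_vector_derivative r (\<lambda>x. \<Sum>k\<le>n. a k * of_real (x ^ k)) =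
           (\<lambda>x. \<Sum>k\<le>n. fact r * of_nat (k choose r) * a k * of_real (x ^ (k - r)))"
proof (induction r)
  case 0
  show ?case by (simp add: nth_vector_derivative_def)
next
  case (Suc r)
  \<comment> \<open>\<open>fact r * (k choose r)\<close> is the falling factorial of
    \<open>k\<close> of length \<open>r\<close>, and \<open>k - r\<close> is its next factor. For
    \<open>k \<le> r\<close> both sides are 0, so truncated subtraction does no harm.\<close>
  have binom: "fact r * of_nat (k choose r) * of_nat (k - r) = fact (Suc r) * (of_nat (k choose Suc r) :: complex)"
    for k
  proof -
    have "Suc r * (k choose Suc r) = (k - r) * (k choose r)"
      by (metis binomial_absorb_comp binomial_absorption)
    hence "(of_nat (Suc r) * of_nat (k choose Suc r) :: complex) = of_nat (k - r) * of_nat (k choose r)"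
      by (simp only: flip: of_nat_mult)
    thus ?thesis
      by (simp add: mult_ac del: of_nat_Suc)
  qed
  show ?case
  proof
    fix x :: real
    have "((\<lambda>x. \<Sum>k\<le>n. fact r * of_nat (k choose r) * a k * of_real (x ^ (k - r))) has_vector_derivative
             (\<Sum>k\<le>n. fact r * of_nat (k choose r) * a k * of_real (real (k - r) * x ^ (k - r - 1)))) (at x)"
      by (intro has_vector_derivative_sum has_vector_derivative_mult_right has_vector_derivative_of_real)
         (auto intro!: derivative_eq_intros)
    also have "(\<Sum>k\<le>n. fact r * of_nat (k choose r) * a k * of_real (real (k - r) * x ^ (k - r - 1))) =
               (\<Sum>k\<le>n. (fact r * of_nat (k choose r) * of_nat (k - r)) * a k * of_real (x ^ (k - Suc r)))"
      by (simp add: mult_ac)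
    finally show "nth_vector_derivative (Suc r) (\<lambda>x. \<Sum>k\<le>n. a k * of_real (x ^ k)) x =
        (\<Sum>k\<le>n. fact (Suc r) * of_nat (k choose Suc r) * a k * of_real (x ^ (k - Suc r)))"
      using Suc unfolding binom
      by (simp add: nth_vector_derivative_def vector_derivative_at)
  qed
qed

text \<open>Splitting off the common factor \<open>fps_binomial c\<close> leaves the binomial
  expansion of \<open>((1 + fps_X) - 1) ^ r\<close>.\<close>

lemma fps_binomial_forward_diff:
  fixes c :: "'a::field_char_0"
  shows "(\<Sum>j=0..r. of_nat (r choose j) * (-1) ^ (r - j) * fps_binomial (c + of_nat j))
           = fps_X ^ r * fps_binomial c"
proof -
  have "fps_X ^ r = ((1 + fps_X) + (-1) :: 'a fps) ^ r"
    by simp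
  also have "\<dots> = (\<Sum>j=0..r. of_nat (r choose j) * (1 + fps_X) ^ j * (-1) ^ (r - j))"
    unfolding binomial_ring atMost_atLeast0 ..
  finally show ?thesis
    by (simp add: sum_distrib_left fps_binomial_add_mult fps_binomial_of_nat mult_ac)
qed

context
  fixes B :: "complex \<Rightarrow> complex" and L U :: "complex fps"
  assumes B: "B analytic_on {0}" "B 0 = 1"
  defines "L \<equiv> fps_expansion (log_branch B) 0"
    and "U \<equiv> fps_expansion (\<lambda>z. B z - 1) 0"
begin

lemma log_branch_expansion: "log_branch B has_fps_expansion L"
  unfolding L_def by (intro analytic_at_imp_has_fps_expansion_0 log_branch_analytic B)

lemma minus_one_expansion: "(\<lambda>z. B z - 1) has_fps_expansion U"
  unfolding U_def by (intro analytic_at_imp_has_fps_expansion_0 analytic_intros B)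

lemma L_nth_0: "fps_nth L 0 = 0"
  using B by (simp add: L_def fps_expansion_def log_branch_0)

lemma U_nth_0: "fps_nth U 0 = 0"
  using B by (simp add: U_def fps_expansion_def)

lemma stirling1_B_eq: "stirling1_B B n k = fact n * (fps_nth (L ^ k) n / fact k)"
  unfolding stirling1_B_def by (rule egf_coeff_power_divide_fact[OF log_branch_expansion])

lemma stirling2_B_eq: "stirling2_B B n k = fact n * (fps_nth (U ^ k) n / fact k)"
  unfolding stirling2_B_def by (rule egf_coeff_power_divide_fact[OF minus_one_expansion])

lemma potential_poly_eq_exp:
  "potential_poly B n x = fact n * fps_nth (fps_exp (of_real x) oo L) n"
proof -
  have "((\<lambda>t. exp (of_real x * t)) \<circ> log_branch B) has_fps_expansion (fps_exp (of_real x) oo L)"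
    by (intro has_fps_expansion_compose has_fps_expansion_exp log_branch_expansion L_nth_0)
  thus ?thesis
    unfolding potential_poly_def by (intro egf_coeff_eqI) (simp add: o_def)
qed

lemma potential_poly_eq_binomial:
  "potential_poly B n x = fact n * fps_nth (fps_binomial (of_real x) oo U) n"
proof -
  have 1: "((\<lambda>t. (1 + t) powr of_real x) \<circ> (\<lambda>z. B z - 1)) has_fps_expansion
          (fps_binomial (of_real x) oo U)"
    by (intro has_fps_expansion_compose has_fps_expansion_binomial_complex minus_one_expansion U_nth_0)
  \<comment> \<open>\<open>powr\<close> agrees with the exponential form where
    \<open>B z \<noteq> 0\<close>, which holds near 0 because \<open>B z\<close> is there a value of
    \<open>exp\<close>.\<close>
  have "\<forall>\<^sub>F z in nhds 0. ((\<lambda>t. (1 + t) powr of_real x) \<circ> (\<lambda>z. B z - 1)) z =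
          exp (of_real x * log_branch B z)"
    using exp_log_branch[OF B]
    by eventually_elim (auto simp: powr_def log_branch_def)
  from 1[unfolded has_fps_expansion_cong[OF this refl]] show ?thesis
    unfolding potential_poly_def by (rule egf_coeff_eqI)
qed

text \<open>Exhibits the polynomial dependence on \<open>x\<close>, so that differentiation can be
  done term by term.\<close>

lemma potential_poly_eq_sum:
  "potential_poly B n x = (\<Sum>k\<le>n. stirling1_B B n k * of_real (x ^ k))"
  by (simp add: potential_poly_eq_exp fps_compose_nth stirling1_B_eq sum_distrib_left
      atMost_atLeast0 mult_ac)

lemma sum_stirling1_B_power:
  "(\<Sum>k=r..n. of_nat (k choose r) * stirling1_B B n k * of_real (x ^ (k - r)))
     = fact n * fps_nth (L ^ r * (fps_exp (of_real x) oo L)) n / fact r"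
  unfolding stirling1_B_eq by (rule fps_compose_egf_nth[OF L_nth_0]) simp

lemma sum_stirling1_B_potential_poly:
  "(\<Sum>j=r..n. of_nat (n choose j) * stirling1_B B j r * potential_poly B (n - j) x)
     = fact n * fps_nth (L ^ r * (fps_exp (of_real x) oo L)) n / fact r"
  unfolding stirling1_B_eq potential_poly_eq_exp
  by (rule fps_mult_egf_nth) (use startsby_zero_power_prefix[OF L_nth_0] in blast)

text \<open>The coefficients of \<open>fps_binomial x\<close> are the falling factorials of
  \<open>x\<close> divided by \<open>fact i\<close>, so they take the place of the powers of
  \<open>x\<close>.\<close>

lemma sum_stirling2_B_falling_factorial:
  "(\<Sum>k=r..n. of_nat (k choose r) * stirling2_B B n k * of_real (falling_factorial x (k - r)))
     = fact n * fps_nth (U ^ r * (fps_binomial (of_real x) oo U)) n / fact r"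
  unfolding stirling2_B_eq
  by (rule fps_compose_egf_nth[OF U_nth_0])
     (simp add: gbinomial_prod_rev falling_factorial_def atLeast0LessThan)

lemma sum_stirling2_B_potential_poly:
  "(\<Sum>j=r..n. of_nat (n choose j) * stirling2_B B j r * potential_poly B (n - j) x)
     = fact n * fps_nth (U ^ r * (fps_binomial (of_real x) oo U)) n / fact r"
  unfolding stirling2_B_eq potential_poly_eq_binomial
  by (rule fps_mult_egf_nth) (use startsby_zero_power_prefix[OF U_nth_0] in blast)

lemma nth_derivative_potential_poly:
  "nth_vector_derivative r (potential_poly B n) x / fact r =
     (\<Sum>k=r..n. of_nat (k choose r) * stirling1_B B n k * of_real (x ^ (k - r)))"
proof -
  have "potential_poly B n = (\<lambda>x. \<Sum>k\<le>n. stirling1_B B n k * of_real (x ^ k))"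
    using potential_poly_eq_sum by blast
  hence "nth_vector_derivative r (potential_poly B n) x / fact r =
      (\<Sum>k\<le>n. of_nat (k choose r) * stirling1_B B n k * of_real (x ^ (k - r)))"
    by (simp add: nth_vector_derivative_polynomial sum_divide_distrib mult.assoc del: of_real_power)
  \<comment> \<open>The dropped terms have \<open>k < r\<close>, where \<open>k choose r\<close> is
    0.\<close>
  also have "\<dots> = (\<Sum>k=r..n. of_nat (k choose r) * stirling1_B B n k * of_real (x ^ (k - r)))"
    by (rule sum.mono_neutral_right) (auto simp: binomial_eq_0)
  finally show ?thesis .
qed

text \<open>Composition with \<open>U\<close> is linear, so it carries the difference identity for
  \<open>fps_binomial\<close> over to the powers of \<open>B\<close>.\<close>

lemma forward_diff_potential_poly:
  "forward_diff r (potential_poly B n) x =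
     fact n * fps_nth (U ^ r * (fps_binomial (of_real x) oo U)) n"
proof -
  \<comment> \<open>As constant series, these weights are fixed by composition and factor out of
    each coefficient.\<close>
  have const: "of_nat (r choose j) * (-1) ^ (r - j) =
      fps_const (of_nat (r choose j) * (-1) ^ (r - j) :: complex)" for j
    by (simp add: fps_of_nat flip: fps_const_mult fps_const_power fps_const_neg fps_const_1_eq_1)
  have "U ^ r * (fps_binomial (of_real x) oo U) = (fps_X ^ r * fps_binomial (of_real x)) oo U"
    using U_nth_0 by (simp add: fps_compose_mult_distrib flip: fps_compose_power)
  also have "\<dots> = (\<Sum>j=0..r. fps_const (of_nat (r choose j) * (-1) ^ (r - j)) *
      (fps_binomial (of_real (x + real j)) oo U))"
    unfolding fps_binomial_forward_diff[symmetric] const fps_compose_sum_distrib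
      fps_compose_mult_distrib[OF U_nth_0]
    by simp
  finally show ?thesis
    by (simp add: forward_diff_def potential_poly_eq_binomial fps_sum_nth sum_distrib_left mult_ac)
qed

end

theorem theorem4:
  fixes B :: "complex \<Rightarrow> complex" and r n :: nat and x :: real
  assumes "B analytic_on {0}" and "B 0 = 1" and "r \<le> n"
  shows
    "(nth_vector_derivative r (potential_poly B n) x / fact r
        = (\<Sum>k=r..n. of_nat (k choose r) * stirling1_B B n k * of_real (x ^ (k - r)))
      \<and> (\<Sum>k=r..n. of_nat (k choose r) * stirling1_B B n k * of_real (x ^ (k - r)))
        = (\<Sum>j=r..n. of_nat (n choose j) * stirling1_B B j r * potential_poly B (n - j) x))
     \<and> (forward_diff r (potential_poly B n) x / fact r
        = (\<Sum>k=r..n. of_nat (k choose r) * stirling2_B B n k * of_real (falling_factorial x (k - r)))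
      \<and> (\<Sum>k=r..n. of_nat (k choose r) * stirling2_B B n k * of_real (falling_factorial x (k - r)))
        = (\<Sum>j=r..n. of_nat (n choose j) * stirling2_B B j r * potential_poly B (n - j) x))
     \<and> nth_vector_derivative r (potential_poly B n) 0 / fact r = stirling1_B B n r
     \<and> forward_diff r (potential_poly B n) 0 / fact r = stirling2_B B n r"
proof (intro conjI)
  note B = assms(1,2)
  \<comment> \<open>Proved for every \<open>x\<close>, to be reused at 0, where only the term
    \<open>k = r\<close> survives.\<close>
  show deriv: "nth_vector_derivative r (potential_poly B n) x / fact r
      = (\<Sum>k=r..n. of_nat (k choose r) * stirling1_B B n k * of_real (x ^ (k - r)))" for x
    by (rule nth_derivative_potential_poly[OF B])
  show "(\<Sum>k=r..n. of_nat (k choose r) * stirling1_B B n k * of_real (x ^ (k - r)))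
      = (\<Sum>j=r..n. of_nat (n choose j) * stirling1_B B j r * potential_poly B (n - j) x)"
    by (simp only: sum_stirling1_B_power[OF B] sum_stirling1_B_potential_poly[OF B])
  show diff: "forward_diff r (potential_poly B n) x / fact r
      = (\<Sum>k=r..n. of_nat (k choose r) * stirling2_B B n k * of_real (falling_factorial x (k - r)))" for x
    by (simp only: forward_diff_potential_poly[OF B] sum_stirling2_B_falling_factorial[OF B])
  show "(\<Sum>k=r..n. of_nat (k choose r) * stirling2_B B n k * of_real (falling_factorial x (k - r)))
      = (\<Sum>j=r..n. of_nat (n choose j) * stirling2_B B j r * potential_poly B (n - j) x)"
    by (simp only: sum_stirling2_B_falling_factorial[OF B] sum_stirling2_B_potential_poly[OF B])
  show "nth_vector_derivative r (potential_poly B n) 0 / fact r = stirling1_B B n r"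
    unfolding deriv using \<open>r \<le> n\<close> by (subst sum.remove[of _ r]) (auto intro!: sum.neutral)
  \<comment> \<open>For \<open>r < k\<close> the product contains the factor with
    \<open>i = 0\<close>, which is 0.\<close>
  have "falling_factorial 0 (k - r) = 0" if "r < k" for k
    using that by (auto simp: falling_factorial_def intro!: prod_zero)
  thus "forward_diff r (potential_poly B n) 0 / fact r = stirling2_B B n r"
    unfolding diff using \<open>r \<le> n\<close>
    by (subst sum.remove[of _ r]) (auto simp: falling_factorial_def intro!: sum.neutral)
qed

end
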